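(* Let $0<c<1$. For every $x=\sum_{j\ge0}x_je_j\in X_c\setminus\{0\}$, $$\|D_cx\|_{X_c}<\|x\|_{X_c}.$$ In particular, $D_c$ does not attain its norm.
   Context: All Banach spaces are real. A bounded linear operator $T:E\to F$ attains its norm if $\|Tx\|=\|T\|$ for some $x$ in the unit sphere of $E$. Definition of $X_c$. A norm $N$ on $\mathbb R^2$ is absolute if $N(s,t)=N(|s|,|t|)$ and normalized if $N(1,0)=N(0,1)=1$. Given a sequence $(N_n)_{n\ge1}$ of absolute normalized norms on $\mathbb R^2$, define norms $M_n$ on $\mathbb R^{n+1}$ by $M_0(x_0)=|x_0|$ and $M_n(x_0,\dots,x_n)=N_n(M_{n-1}(x_0,\dots,x_{n-1}),|x_n|)$ for $n\ge1$. For a finitely supported real sequence $x=(x_j)_{j\ge0}\in c_{00}$ put $\|x\|=M_n(x_0,\dots,x_n)$ for any $n$ with $x_j=0$ for all $j>n$ (this is independent of $n$). $A(N_n)$ denotes the completion of $c_{00}$ in this norm, with canonical basis $(e_j)_{j\ge0}$. For $0<c<1$ and $n\ge1$ let $$N_{n,c}(s,t)=\left[(1-c^{2n})|t|^{2n}+(s^2+c^2t^2)^n\right]^{1/(2n)},$$ which is an absolute normalized norm on $\mathbb R^2$, and set $X_c:=A(N_{n,c})$. The canonical basis $(e_j)_{j\ge0}$ of $X_c$ is a ($1$-unconditional) Schauder basis. The operator $D_c$ is the bounded linear operator on $X_c$ determined by $D_ce_0=0$ and $D_ce_n=\frac{n}{n+1}e_n$ for $n\ge1$; it satisfies $\|D_c\|=1$.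 *)

theory Defs
  imports "HOL-Analysis.Analysis"
begin

text \<open>The norm \<open>M\<^sub>n\<close> on \<open>\<real>\<^sup>n\<^sup>+\<^sup>1\<close>: a vector is given by a sequence,
  of which only the coordinates \<open>0, \<dots>, n\<close> are used. The value \<open>N 0\<close> is never used.\<close>

primrec M_norm :: "(nat \<Rightarrow> real \<Rightarrow> real \<Rightarrow> real) \<Rightarrow> nat \<Rightarrow> (nat \<Rightarrow> real) \<Rightarrow> real" where
  "M_norm N 0 x = \<bar>x 0\<bar>"
| "M_norm N (Suc n) x = N (Suc n) (M_norm N n x) \<bar>x (Suc n)\<bar>"

definition c00 :: "(nat \<Rightarrow> real) set" where
  "c00 = {x. finite {j. x j \<noteq> 0}}"

text \<open>Any \<open>n\<close> with \<open>x j = 0\<close> for all \<open>j > n\<close> gives the same value when every \<open>N k\<close> is absolute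
  and normalized; the least one is taken here.\<close>

definition c00_norm :: "(nat \<Rightarrow> real \<Rightarrow> real \<Rightarrow> real) \<Rightarrow> (nat \<Rightarrow> real) \<Rightarrow> real" where
  "c00_norm N x = M_norm N (LEAST n. \<forall>j>n. x j = 0) x"

text \<open>The Banach space \<open>'a\<close>, with the map \<open>\<iota>\<close>, is the completion \<open>A(N\<^sub>n)\<close> of \<open>c00\<close>:
  \<open>\<iota>\<close> is a linear isometry from \<open>c00\<close> onto a dense subspace of \<open>'a\<close>. Values of \<open>\<iota>\<close>
  outside \<open>c00\<close> are irrelevant. Completeness is part of the class \<open>banach\<close>.\<close>

definition completion_A ::
  "(nat \<Rightarrow> real \<Rightarrow> real \<Rightarrow> real) \<Rightarrow> ((nat \<Rightarrow> real) \<Rightarrow> 'a::banach) \<Rightarrow> bool" where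
  "completion_A N \<iota> \<longleftrightarrow>
     (\<forall>x\<in>c00. \<forall>y\<in>c00. \<iota> (\<lambda>j. x j + y j) = \<iota> x + \<iota> y) \<and>
     (\<forall>a. \<forall>x\<in>c00. \<iota> (\<lambda>j. a * x j) = a *\<^sub>R \<iota> x) \<and>
     (\<forall>x\<in>c00. norm (\<iota> x) = c00_norm N x) \<and>
     closure (\<iota> ` c00) = UNIV"

definition canonical_basis :: "((nat \<Rightarrow> real) \<Rightarrow> 'a) \<Rightarrow> nat \<Rightarrow> 'a" where
  "canonical_basis \<iota> n = \<iota> (\<lambda>j. if j = n then 1 else 0)"

definition N_c :: "real \<Rightarrow> nat \<Rightarrow> real \<Rightarrow> real \<Rightarrow> real" where
  "N_c c n s t = root (2 * n) ((1 - c ^ (2 * n)) * \<bar>t\<bar> ^ (2 * n) + (s\<^sup>2 + c\<^sup>2 * t\<^sup>2) ^ n)"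

text \<open>The operator \<open>D\<^sub>c\<close> on \<open>X\<^sub>c\<close>; it depends on \<open>c\<close> through the space \<open>'a\<close> and the map \<open>\<iota>\<close>.\<close>

definition D_op :: "((nat \<Rightarrow> real) \<Rightarrow> 'a::banach) \<Rightarrow> 'a \<Rightarrow> 'a" where
  "D_op \<iota> = (THE D. bounded_linear D \<and> D (canonical_basis \<iota> 0) = 0 \<and>
     (\<forall>n\<ge>1. D (canonical_basis \<iota> n) = (real n / real (n + 1)) *\<^sub>R canonical_basis \<iota> n))"

definition attains_norm :: "('a::real_normed_vector \<Rightarrow> 'b::real_normed_vector) \<Rightarrow> bool" where
  "attains_norm T \<longleftrightarrow> (\<exists>x. norm x = 1 \<and> norm (T x) = onorm T)"

end

theory Submission
  imports Defs "HOL-Real_Asymp.Real_Asymp"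
begin

text \<open>
  Let \<open>x \<noteq> 0\<close> have coordinates \<open>x\<^sub>j\<close>, put \<open>y\<^sub>j = j/(j+1) x\<^sub>j\<close>, and write \<open>b\<^sub>n\<close>, \<open>a\<^sub>n\<close> for the
  \<open>n\<close>-th iterated norms of \<open>x\<close> and \<open>y\<close>, so that \<open>b\<^sub>n\<close> increases to the norm \<open>b\<close> of \<open>x\<close> and \<open>a\<^sub>n\<close> to
  the norm \<open>a\<close> of its image. Each \<open>N\<^sub>n\<close> is monotone, and strictly so in its second argument;
  hence \<open>a\<^sub>n < b\<^sub>n\<close> as soon as \<open>b\<^sub>n > 0\<close> (\<open>M_norm_strict_contraction\<close>). The point is that
  strictness survives the limit.

  It does because, for large \<open>n\<close> and \<open>t\<close> small against \<open>s\<close>, the norm \<open>N\<^sub>n(s, t)\<close> is close to the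
  Euclidean norm of \<open>(s, c t)\<close>.
  On the one hand \<open>b\<^sub>n\<^sup>2 \<ge> b\<^sub>n\<^sub>-\<^sub>1\<^sup>2 + c\<^sup>2 x\<^sub>n\<^sup>2\<close> always (\<open>N_c_square_lower\<close>). On the other hand
  \<open>a\<^sub>n\<^sup>2 \<le> a\<^sub>n\<^sub>-\<^sub>1\<^sup>2 + c\<^sup>2 y\<^sub>n\<^sup>2 + y\<^sub>n\<^sup>2 (y\<^sub>n/a\<^sub>n\<^sub>-\<^sub>1)\<^sup>2\<^sup>n\<^sup>-\<^sup>2\<close> (\<open>N_c_square_upper\<close>), and unless \<open>y = 0\<close> the
  last term is exponentially small relative to \<open>y\<^sub>n\<^sup>2\<close>, since \<open>y\<^sub>n\<close> tends to \<open>0\<close> while \<open>a\<^sub>n\<^sub>-\<^sub>1\<close> stays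
  away from \<open>0\<close>. The gain \<open>c\<^sup>2 (x\<^sub>n\<^sup>2 - y\<^sub>n\<^sup>2)\<close>, which is only of relative order \<open>1/n\<close>, absorbs it.
  So \<open>b\<^sub>n\<^sup>2 - a\<^sub>n\<^sup>2\<close> is eventually nondecreasing, and its limit \<open>b\<^sup>2 - a\<^sup>2\<close> is at least one of its
  positive terms (\<open>weighted_limit_strict\<close>).

  To apply this in the completion, the coordinates are extended from \<open>c00\<close> by density, and the
  partial sums \<open>P n u\<close> are shown to converge to \<open>u\<close>. The operator is the extension by density of
  coordinatewise multiplication on \<open>c00\<close>, and a bounded operator is determined by its values on
  the basis. Finally the images of the basis vectors show that the operator norm is at least \<open>1\<close>,
  a value that no unit vector can reach because of the strict inequality.
\<close>

section \<open>The two-dimensional norms\<close>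

lemma N_c_nonneg:
  assumes "0 < c" "c < 1"
  shows "0 \<le> N_c c n s t"
proof -
  have "c ^ (2 * n) \<le> 1" using assms by (simp add: power_le_one)
  then show ?thesis unfolding N_c_def by (cases "n = 0") simp_all
qed

lemma N_c_power:
  assumes "0 < c" "c < 1" "1 \<le> n"
  shows "((N_c c n s t)\<^sup>2) ^ n = (1 - c ^ (2 * n)) * (t\<^sup>2) ^ n + (s\<^sup>2 + c\<^sup>2 * t\<^sup>2) ^ n"
proof -
  have "c ^ (2 * n) \<le> 1" using assms by (simp add: power_le_one)
  then have "(root (2 * n) ((1 - c ^ (2 * n)) * \<bar>t\<bar> ^ (2 * n) + (s\<^sup>2 + c\<^sup>2 * t\<^sup>2) ^ n)) ^ (2 * n)
      = (1 - c ^ (2 * n)) * \<bar>t\<bar> ^ (2 * n) + (s\<^sup>2 + c\<^sup>2 * t\<^sup>2) ^ n"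
    using assms by (intro real_root_pow_pos2) auto
  then show ?thesis by (simp add: N_c_def power_mult)
qed

lemma N_c_mono:
  assumes "0 < c" "c < 1" "\<bar>s\<bar> \<le> \<bar>s'\<bar>" "\<bar>t\<bar> \<le> \<bar>t'\<bar>"
  shows "N_c c n s t \<le> N_c c n s' t'"
proof (cases "n = 0")
  case True then show ?thesis by (simp add: N_c_def)
next
  case False
  have c: "c ^ (2 * n) \<le> 1" using assms by (simp add: power_le_one)
  have "s\<^sup>2 \<le> s'\<^sup>2" "t\<^sup>2 \<le> t'\<^sup>2" using assms by (simp_all add: abs_le_square_iff)
  then have "s\<^sup>2 + c\<^sup>2 * t\<^sup>2 \<le> s'\<^sup>2 + c\<^sup>2 * t'\<^sup>2"
    by (simp add: add_mono mult_left_mono)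
  then have "(s\<^sup>2 + c\<^sup>2 * t\<^sup>2) ^ n \<le> (s'\<^sup>2 + c\<^sup>2 * t'\<^sup>2) ^ n"
    by (rule power_mono) simp
  moreover have "\<bar>t\<bar> ^ (2 * n) \<le> \<bar>t'\<bar> ^ (2 * n)" using assms by (intro power_mono) auto
  ultimately show ?thesis
    unfolding N_c_def using False c by (intro real_root_le_mono add_mono mult_left_mono) simp_all
qed

lemma N_c_strict_mono_right:
  assumes "0 < c" "c < 1" "1 \<le> n" "\<bar>t\<bar> < \<bar>t'\<bar>"
  shows "N_c c n s t < N_c c n s t'"
proof -
  have c: "c ^ (2 * n) < 1" using assms by (simp add: power_less_one_iff)
  have "t\<^sup>2 \<le> t'\<^sup>2" using assms by (simp flip: abs_le_square_iff)
  then have "s\<^sup>2 + c\<^sup>2 * t\<^sup>2 \<le> s\<^sup>2 + c\<^sup>2 * t'\<^sup>2"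
    by (simp add: mult_left_mono)
  then have "(s\<^sup>2 + c\<^sup>2 * t\<^sup>2) ^ n \<le> (s\<^sup>2 + c\<^sup>2 * t'\<^sup>2) ^ n"
    by (rule power_mono) simp
  moreover have "\<bar>t\<bar> ^ (2 * n) < \<bar>t'\<bar> ^ (2 * n)"
    using assms by (intro power_strict_mono) auto
  ultimately show ?thesis
    unfolding N_c_def using assms c
    by (intro real_root_less_mono add_less_le_mono mult_strict_left_mono) simp_all
qed

lemma N_c_zero_right:
  assumes "1 \<le> n" "0 \<le> s"
  shows "N_c c n s 0 = s"
proof -
  have "(s\<^sup>2) ^ n = s ^ (2 * n)" by (simp add: power_mult)
  then have "N_c c n s 0 = root (2 * n) (s ^ (2 * n))"
    using assms by (simp add: N_c_def zero_power)
  then show ?thesis using assms by (simp add: real_root_power_cancel)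
qed

lemma N_c_zero_left:
  assumes "1 \<le> n"
  shows "N_c c n 0 t = \<bar>t\<bar>"
proof -
  have "(c\<^sup>2 * t\<^sup>2) ^ n = c ^ (2 * n) * \<bar>t\<bar> ^ (2 * n)"
    by (simp add: power_mult power_mult_distrib)
  then have "N_c c n 0 t = root (2 * n) (\<bar>t\<bar> ^ (2 * n))"
    by (simp add: N_c_def left_diff_distrib)
  then show ?thesis using assms by (simp add: real_root_power_cancel del: power_abs)
qed

lemma N_c_square_lower:
  assumes "0 < c" "c < 1" "1 \<le> n"
  shows "s\<^sup>2 + c\<^sup>2 * t\<^sup>2 \<le> (N_c c n s t)\<^sup>2"
proof (rule power_le_imp_le_base)
  have "c ^ (2 * n) \<le> 1" using assms by (simp add: power_le_one)
  then have "(s\<^sup>2 + c\<^sup>2 * t\<^sup>2) ^ n \<le> ((N_c c n s t)\<^sup>2) ^ n"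
    unfolding N_c_power[OF assms] by simp
  then show "(s\<^sup>2 + c\<^sup>2 * t\<^sup>2) ^ Suc (n - 1) \<le> ((N_c c n s t)\<^sup>2) ^ Suc (n - 1)"
    using assms(3) by (simp only: Suc_diff_le[symmetric] diff_Suc_Suc One_nat_def minus_nat.diff_0)
qed simp

text \<open>The reason is Bernoulli's inequality, applied to \<open>(A + h)\<^sup>n\<close> with \<open>A = s\<^sup>2 + c\<^sup>2 t\<^sup>2\<close> and
  \<open>h = t\<^sup>2 (t\<^sup>2/A)\<^sup>n\<^sup>-\<^sup>1\<close>, so that \<open>A\<^sup>n\<^sup>-\<^sup>1 h = t\<^sup>2\<^sup>n\<close>. For \<open>t\<close> small against \<open>s\<close>
  and \<open>n\<close> large, the lower bound \<open>A\<close> for the square of the norm is therefore almost exact.\<close>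

lemma N_c_square_upper:
  assumes c: "0 < c" "c < 1" and n: "1 \<le> n" and "s \<noteq> 0"
  shows "(N_c c n s t)\<^sup>2 \<le> s\<^sup>2 + c\<^sup>2 * t\<^sup>2 + t\<^sup>2 * (t\<^sup>2 / s\<^sup>2) ^ (n - 1)"
proof -
  define A where "A = s\<^sup>2 + c\<^sup>2 * t\<^sup>2"
  define h where "h = t\<^sup>2 * (t\<^sup>2 / A) ^ (n - 1)"
  have s: "0 < s\<^sup>2" "s\<^sup>2 \<le> A" using \<open>s \<noteq> 0\<close> by (auto simp: A_def)
  then have A: "0 < A" by linarith
  have h: "0 \<le> h" using A by (simp add: h_def)
  obtain k where k: "n = Suc k" using n by (cases n) auto
  have "((N_c c n s t)\<^sup>2) ^ n \<le> (t\<^sup>2) ^ n + A ^ n"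
    unfolding N_c_power[OF c n] A_def using c by (simp add: mult_left_le_one_le power_le_one)
  also have "(t\<^sup>2) ^ n = A ^ n * (h / A)"
    using A by (simp add: h_def k power_divide field_simps)
  also have "\<dots> + A ^ n \<le> A ^ n * (1 + real n * (h / A))"
  proof -
    have "1 * (h / A) \<le> real n * (h / A)" using n h A by (intro mult_right_mono) auto
    then have "A ^ n * (1 + h / A) \<le> A ^ n * (1 + real n * (h / A))"
      using A by (intro mult_left_mono) auto
    then show ?thesis by (simp add: algebra_simps)
  qed
  also have "\<dots> \<le> A ^ n * (1 + h / A) ^ n"
    using Bernoulli_inequality[of "h / A" n] order_trans[of "-1" 0 "h / A"] h A
    by (intro mult_left_mono) simp_all
  also have "\<dots> = (A + h) ^ n"
    using A by (simp add: field_simps flip: power_mult_distrib)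
  finally have "((N_c c n s t)\<^sup>2) ^ Suc k \<le> (A + h) ^ Suc k" by (simp add: k)
  then have "(N_c c n s t)\<^sup>2 \<le> A + h"
    by (rule power_le_imp_le_base) (use A h in simp)
  moreover have "h \<le> t\<^sup>2 * (t\<^sup>2 / s\<^sup>2) ^ (n - 1)"
    unfolding h_def using s A by (intro mult_left_mono power_mono divide_left_mono) simp_all
  ultimately show ?thesis by (simp add: A_def)
qed

section \<open>The iterated norms\<close>

lemma M_norm_nonneg:
  assumes "0 < c" "c < 1"
  shows "0 \<le> M_norm (N_c c) n x"
  using assms by (cases n) (auto intro: N_c_nonneg)

lemma M_norm_mono:
  assumes "0 < c" "c < 1" "\<And>j. j \<le> n \<Longrightarrow> \<bar>x j\<bar> \<le> \<bar>y j\<bar>"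
  shows "M_norm (N_c c) n x \<le> M_norm (N_c c) n y"
  using assms(3)
proof (induction n)
  case (Suc n)
  then show ?case
    using M_norm_nonneg[OF assms(1,2)] by (auto intro!: N_c_mono assms(1,2))
qed simp

lemma M_norm_cong:
  assumes "\<And>j. j \<le> n \<Longrightarrow> x j = y j"
  shows "M_norm N n x = M_norm N n y"
  using assms by (induction n) auto

lemma M_norm_le_Suc:
  assumes "0 < c" "c < 1"
  shows "M_norm (N_c c) n x \<le> M_norm (N_c c) (Suc n) x"
  using N_c_mono[OF assms, of "M_norm (N_c c) n x" "M_norm (N_c c) n x" 0 "\<bar>x (Suc n)\<bar>" "Suc n"]
    N_c_zero_right[of "Suc n"] M_norm_nonneg[OF assms] by simp

lemma incseq_M_norm:
  assumes "0 < c" "c < 1"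
  shows "incseq (\<lambda>n. M_norm (N_c c) n x)"
  using M_norm_le_Suc[OF assms] by (rule incseq_SucI)

lemma abs_coordinate_le_M_norm:
  assumes c: "0 < c" "c < 1" and "j \<le> n"
  shows "\<bar>x j\<bar> \<le> M_norm (N_c c) n x"
proof -
  have "\<bar>x j\<bar> \<le> M_norm (N_c c) j x"
  proof (cases j)
    case (Suc k)
    then show ?thesis
      using N_c_mono[OF c, of 0 "M_norm (N_c c) k x" "x j" "\<bar>x j\<bar>" j]
        N_c_zero_left[of j c "x j"] by simp
  qed simp
  also have "\<dots> \<le> M_norm (N_c c) n x" using incseq_M_norm[OF c] \<open>j \<le> n\<close> by (rule incseqD)
  finally show ?thesis .
qed

lemma M_norm_eq_beyond_support:
  assumes c: "0 < c" "c < 1" and "m \<le> n" "\<And>j. m < j \<Longrightarrow> x j = 0"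
  shows "M_norm (N_c c) n x = M_norm (N_c c) m x"
  using \<open>m \<le> n\<close>
proof (induction n rule: dec_induct)
  case (step n)
  then show ?case using assms(4)[of "Suc n"] N_c_zero_right[of "Suc n"] M_norm_nonneg[OF c] by simp
qed simp

lemma c00_norm_eq_M_norm:
  assumes c: "0 < c" "c < 1" and n: "\<And>j. n < j \<Longrightarrow> x j = 0"
  shows "c00_norm (N_c c) x = M_norm (N_c c) n x"
proof -
  define m where "m = (LEAST n. \<forall>j>n. x j = 0)"
  have "\<forall>j>m. x j = 0" unfolding m_def by (rule LeastI[of _ n]) (use n in auto)
  moreover have "m \<le> n" unfolding m_def by (rule Least_le) (use n in auto)
  ultimately show ?thesis
    using M_norm_eq_beyond_support[OF c, of m n x] unfolding c00_norm_def m_def[symmetric] by simp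
qed

lemma c00_bounded_support:
  assumes "x \<in> c00"
  obtains n where "\<And>j. n < j \<Longrightarrow> x j = 0"
proof -
  have "finite {j. x j \<noteq> 0}" using assms by (simp add: c00_def)
  then obtain n where "\<forall>j\<in>{j. x j \<noteq> 0}. j \<le> n" using finite_nat_set_iff_bounded_le by blast
  then show thesis using that[of n] by force
qed

lemma c00I: "(\<And>j. n < j \<Longrightarrow> x j = 0) \<Longrightarrow> x \<in> c00"
  unfolding c00_def mem_Collect_eq by (rule finite_subset[of _ "{..n}"]) (use not_le in blast)+

lemma c00_add: "x \<in> c00 \<Longrightarrow> y \<in> c00 \<Longrightarrow> (\<lambda>j. x j + y j) \<in> c00"
  unfolding c00_def by (auto intro: finite_subset[of _ "{j. x j \<noteq> 0} \<union> {j. y j \<noteq> 0}"])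

lemma c00_mult: "x \<in> c00 \<Longrightarrow> (\<lambda>j. a j * x j) \<in> c00"
  unfolding c00_def by (auto intro: finite_subset[of _ "{j. x j \<noteq> 0}"])

lemma unit_c00: "(\<lambda>j. if j = n then 1 else 0) \<in> c00"
  by (rule c00I[of n]) simp

section \<open>Extension by density\<close>

text \<open>Both the coordinate functionals and the operator arise in this way. The bound makes \<open>T x\<close>
  depend on \<open>\<iota> x\<close> only, and \<open>1\<close>-Lipschitz in it; this extends by uniform continuity, and
  linearity is a closed condition.\<close>

lemma bounded_linear_extension:
  fixes \<iota> :: "(nat \<Rightarrow> real) \<Rightarrow> 'a::real_normed_vector"
    and T :: "(nat \<Rightarrow> real) \<Rightarrow> 'b::banach"
  assumes add: "\<And>x y. x \<in> c00 \<Longrightarrow> y \<in> c00 \<Longrightarrow> \<iota> (\<lambda>j. x j + y j) = \<iota> x + \<iota> y"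
    and scale: "\<And>a x. x \<in> c00 \<Longrightarrow> \<iota> (\<lambda>j. a * x j) = a *\<^sub>R \<iota> x"
    and dense: "closure (\<iota> ` c00) = UNIV"
    and T_add: "\<And>x y. x \<in> c00 \<Longrightarrow> y \<in> c00 \<Longrightarrow> T (\<lambda>j. x j + y j) = T x + T y"
    and T_scale: "\<And>a x. x \<in> c00 \<Longrightarrow> T (\<lambda>j. a * x j) = a *\<^sub>R T x"
    and bound: "\<And>x. x \<in> c00 \<Longrightarrow> norm (T x) \<le> norm (\<iota> x)"
  obtains L where "bounded_linear L" "\<And>x. x \<in> c00 \<Longrightarrow> L (\<iota> x) = T x"
    "\<And>u. norm (L u) \<le> norm u"
proof -
  have lip: "dist (T x) (T y) \<le> dist (\<iota> x) (\<iota> y)" if "x \<in> c00" "y \<in> c00" for x y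
  proof -
    have my: "(\<lambda>j. (-1) * y j) \<in> c00" using that by (intro c00_mult)
    have "T (\<lambda>j. x j + (-1) * y j) = T x - T y" 
      using T_add[OF that(1) my] T_scale[OF that(2), of "-1"] by simp
    moreover have "\<iota> (\<lambda>j. x j + (-1) * y j) = \<iota> x - \<iota> y"
      using add[OF that(1) my] scale[OF that(2), of "-1"] by simp
    ultimately show ?thesis
      using bound[OF c00_add[OF that(1) my]] by (simp add: dist_norm)
  qed
  \<comment> \<open>\<open>T\<close> as a function on the dense subspace \<open>\<iota> ` c00\<close>; well defined by \<open>lip\<close>\<close>
  define f where "f u = T (SOME x. x \<in> c00 \<and> \<iota> x = u)" for u
  have f: "f (\<iota> x) = T x" if "x \<in> c00" for x
  proof -
    have "(SOME y. y \<in> c00 \<and> \<iota> y = \<iota> x) \<in> c00 \<and> \<iota> (SOME y. y \<in> c00 \<and> \<iota> y = \<iota> x) = \<iota> x"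
      by (rule someI[of _ x]) (use that in simp)
    then have "dist (f (\<iota> x)) (T x) \<le> 0" unfolding f_def using lip that by fastforce
    then show ?thesis by simp
  qed
  have "uniformly_continuous_on (\<iota> ` c00) f"
    unfolding uniformly_continuous_on_def
  proof (intro allI impI)
    fix e :: real assume "0 < e"
    then show "\<exists>d>0. \<forall>u\<in>\<iota> ` c00. \<forall>v\<in>\<iota> ` c00. dist v u < d \<longrightarrow> dist (f v) (f u) < e"
      by (intro exI[of _ e]) (auto simp: f intro: le_less_trans[OF lip])
  qed
  then obtain L where L: "uniformly_continuous_on UNIV L"
    and Lf: "\<And>u. u \<in> \<iota> ` c00 \<Longrightarrow> f u = L u"
    using uniformly_continuous_on_extension_on_closure[of "\<iota> ` c00" f] dense by metis
  have LT: "L (\<iota> x) = T x" if "x \<in> c00" for x using Lf f that by force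
  have cont: "continuous_on UNIV L" using L by (rule uniformly_continuous_imp_continuous)
  note [continuous_intros] = continuous_on_compose2[OF cont]
  have norm: "norm (L u) \<le> norm u" for u
    by (rule continuous_le_on_closure[where S = "\<iota> ` c00" and f = "\<lambda>u. norm (L u) - norm u" 
          and a = 0 and x = u, simplified])
      (auto simp: dense LT bound intro!: continuous_intros)
  have dense2: "closure ((\<iota> ` c00) \<times> (\<iota> ` c00)) = UNIV" by (simp add: closure_Times dense)
  have "L (fst q + snd q) - L (fst q) - L (snd q) = 0" for q
    by (rule continuous_constant_on_closure[where S = "(\<iota> ` c00) \<times> (\<iota> ` c00)"
          and f = "\<lambda>q. L (fst q + snd q) - L (fst q) - L (snd q)"])
      (auto simp: dense2 LT c00_add T_add simp flip: add intro!: continuous_intros)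
  from this[of "(u, v)" for u v] have L_add: "L (u + v) = L u + L v" for u v
    by (simp add: algebra_simps)
  have "L (a *\<^sub>R u) - a *\<^sub>R L u = 0" for a u
    by (rule continuous_constant_on_closure[where S = "\<iota> ` c00"
          and f = "\<lambda>u. L (a *\<^sub>R u) - a *\<^sub>R L u"])
      (auto simp: dense LT c00_mult T_scale simp flip: scale intro!: continuous_intros)
  then have "L (a *\<^sub>R u) = a *\<^sub>R L u" for a u by simp
  then have "bounded_linear L" by (intro bounded_linear_intro[of _ 1]) (auto simp: L_add norm)
  then show thesis using that LT norm by blast
qed


lemma bounded_linear_eq_on_dense:
  fixes f g :: "'a::real_normed_vector \<Rightarrow> 'b::real_normed_vector"
  assumes "bounded_linear f" "bounded_linear g" "closure S = UNIV" "\<And>u. u \<in> S \<Longrightarrow> f u = g u"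
  shows "f = g"
proof
  fix u
  have "f u - g u = 0"
    by (rule continuous_constant_on_closure[where S = S and f = "\<lambda>u. f u - g u"])
      (auto simp: assms intro!: linear_continuous_on bounded_linear_sub)
  then show "f u = g u" by simp
qed

section \<open>Strict contraction for sequences\<close>

text \<open>At a step with \<open>x (Suc n) \<noteq> 0\<close> the last coordinate alone already gives strictness; at the
  other steps neither norm changes, and the strict inequality is inherited.\<close>

lemma M_norm_strict_contraction:
  assumes c: "0 < c" "c < 1"
    and y: "\<And>j. \<bar>y j\<bar> \<le> \<bar>x j\<bar>" "\<And>j. x j \<noteq> 0 \<Longrightarrow> \<bar>y j\<bar> < \<bar>x j\<bar>"
    and pos: "0 < M_norm (N_c c) n x"
  shows "M_norm (N_c c) n y < M_norm (N_c c) n x"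
  using pos
proof (induction n)
  case 0
  then show ?case using y(2)[of 0] by simp
next
  case (Suc n)
  show ?case
  proof (cases "x (Suc n) = 0")
    case True
    moreover from this have "y (Suc n) = 0" using y(1)[of "Suc n"] by simp
    ultimately show ?thesis
      using Suc N_c_zero_right[of "Suc n"] M_norm_nonneg[OF c] by simp
  next
    case False
    have "M_norm (N_c c) (Suc n) y \<le> N_c c (Suc n) (M_norm (N_c c) n x) \<bar>y (Suc n)\<bar>"
      using M_norm_mono[OF c, of n y x] M_norm_nonneg[OF c] y(1) by (auto intro!: N_c_mono c)
    also have "\<dots> < M_norm (N_c c) (Suc n) x"
      using y(2)[OF False] by (auto intro!: N_c_strict_mono_right c)
    finally show ?thesis .
  qed
qed

lemma abs_weight_mult_le: "\<bar>real j / real (j + 1) * t\<bar> \<le> \<bar>t\<bar>"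
  by (simp add: abs_mult divide_simps) (simp add: algebra_simps)

text \<open>The differences of the squared norms are nondecreasing from an index \<open>m\<close> on. Working with
  differences of squares instead of quotients avoids any infinite product: the excess of \<open>N\<^sub>n\<close> over
  the Euclidean norm only has to be paid for, term by term, by \<open>c\<^sup>2 (x\<^sub>n\<^sup>2 - y\<^sub>n\<^sup>2)\<close>.\<close>

lemma weighted_limit_strict:
  assumes c: "0 < c" "c < 1"
    and y: "\<And>j. y j = real j / real (j + 1) * x j"
    and x0: "x \<longlonglongrightarrow> 0"
    and a: "(\<lambda>n. M_norm (N_c c) n y) \<longlonglongrightarrow> a"
    and b: "(\<lambda>n. M_norm (N_c c) n x) \<longlonglongrightarrow> b"
    and "0 < b"
  shows "a < b"
proof (cases "a \<le> 0")
  case True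
  then show ?thesis using \<open>0 < b\<close> by simp
next
  case False
  then have "0 < a" by simp
  let ?A = "\<lambda>n. M_norm (N_c c) n y" and ?B = "\<lambda>n. M_norm (N_c c) n x"
  have shrink: "\<bar>y j\<bar> \<le> \<bar>x j\<bar>" for j
    unfolding y by (rule abs_weight_mult_le)
  have shrink': "\<bar>y j\<bar> < \<bar>x j\<bar>" if "x j \<noteq> 0" for j
    using that by (simp add: y abs_mult divide_simps)
  have "y \<longlonglongrightarrow> 0" using x0 by (rule Lim_transform_bound[rotated]) (simp add: shrink)
  obtain m0 where m0: "0 < ?A m0"
    using order_tendstoD(1)[OF a \<open>0 < a\<close>] unfolding eventually_sequentially by blast
  define \<alpha> where "\<alpha> = (?A m0)\<^sup>2"
  have \<alpha>: "0 < \<alpha>" using m0 by (simp add: \<alpha>_def)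
  have "(\<lambda>n. (y n)\<^sup>2) \<longlonglongrightarrow> 0" using tendsto_power[OF \<open>y \<longlonglongrightarrow> 0\<close>, of 2] by simp
  then have ev1: "\<forall>\<^sub>F n in sequentially. (y n)\<^sup>2 < \<alpha> / 2"
    by (rule order_tendstoD(2)) (use \<alpha> in simp)
  \<comment> \<open>The excess at step \<open>Suc n\<close> is at most \<open>(1/2) ^ n\<close> times \<open>(y (Suc n))\<^sup>2\<close>; the available
    room is \<open>c\<^sup>2 / (n + 2)\<close> times \<open>(y (Suc n))\<^sup>2\<close>.\<close>
  have "(\<lambda>n. real (n + 2) * (1/2) ^ n) \<longlonglongrightarrow> 0" by real_asymp
  then have ev2: "\<forall>\<^sub>F n in sequentially. real (n + 2) * (1/2) ^ n < c\<^sup>2"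
    by (rule order_tendstoD(2)) (use c in simp)
  obtain m where "\<forall>n\<ge>m. m0 \<le> n \<and> (y n)\<^sup>2 < \<alpha> / 2 \<and> real (n + 2) * (1/2) ^ n < c\<^sup>2"
    using eventually_conj[OF eventually_ge_at_top[of m0] eventually_conj[OF ev1 ev2]]
    unfolding eventually_sequentially by blast
  then have m: "m0 \<le> m" "\<And>n. m \<le> n \<Longrightarrow> (y n)\<^sup>2 < \<alpha> / 2"
      "\<And>n. m \<le> n \<Longrightarrow> real (n + 2) * (1/2) ^ n < c\<^sup>2"
    by blast+
  have incA: "?A m0 \<le> ?A n" if "m \<le> n" for n
    using incseqD[OF incseq_M_norm[OF c], of m0 n y] m(1) that by simp
  have step_le: "(?B n)\<^sup>2 - (?A n)\<^sup>2 \<le> (?B (Suc n))\<^sup>2 - (?A (Suc n))\<^sup>2" if n: "m \<le> n" for n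
  proof -
    let ?T = "(y (Suc n))\<^sup>2"
    have A0: "0 < ?A n" using m0 incA[OF n] by linarith
    have "\<alpha> \<le> (?A n)\<^sup>2" unfolding \<alpha>_def using m0 incA[OF n] by (intro power_mono) auto
    then have "?T / (?A n)\<^sup>2 \<le> 1/2"
      using m(2)[of "Suc n"] n A0 by (simp add: pos_divide_le_eq)
    then have "(?T / (?A n)\<^sup>2) ^ n \<le> (1/2) ^ n" by (intro power_mono) auto
    also have "\<dots> \<le> c\<^sup>2 / real (n + 2)" using m(3)[OF n] by (subst pos_le_divide_eq) (simp_all add: mult.commute)
    finally have "?T * (?T / (?A n)\<^sup>2) ^ n \<le> ?T * (c\<^sup>2 / real (n + 2))"
      by (intro mult_left_mono) auto
    then have up: "(?A (Suc n))\<^sup>2 \<le> (?A n)\<^sup>2 + c\<^sup>2 * (?T * (1 + 1 / real (n + 2)))"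
      using N_c_square_upper[OF c, of "Suc n" "?A n" "\<bar>y (Suc n)\<bar>"] A0 by (simp add: algebra_simps)
    \<comment> \<open>With \<open>k = n + 1\<close>: shrinking by \<open>k/(k+1)\<close> leaves room for a factor \<open>1 + 1/(k+1)\<close> in the
      square, as \<open>k\<^sup>2 (k + 2) \<le> (k + 1) ^ 3\<close>.\<close>
    have "((real n + 1) / (real n + 2))\<^sup>2 * (1 + 1 / real (n + 2)) \<le> 1"
    proof -
      have "((real n + 1) / (real n + 2))\<^sup>2 * (1 + 1 / real (n + 2))
          = (real n + 1)\<^sup>2 * (real n + 3) / (real n + 2) ^ 3"
        by (simp add: field_simps power2_eq_square power3_eq_cube)
      also have "\<dots> \<le> 1" 
        by (simp add: divide_simps) (simp add: algebra_simps power2_eq_square power3_eq_cube)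
      finally show ?thesis .
    qed
    then have "?T * (1 + 1 / real (n + 2)) \<le> (x (Suc n))\<^sup>2"
      using mult_right_mono[of "((real n + 1) / (real n + 2))\<^sup>2 * (1 + 1 / real (n + 2))" 1 "(x (Suc n))\<^sup>2"]
      by (simp add: y power_mult_distrib power_divide mult_ac add_ac)
    then have "c\<^sup>2 * (?T * (1 + 1 / real (n + 2))) \<le> c\<^sup>2 * (x (Suc n))\<^sup>2"
      by (intro mult_left_mono) auto
    moreover have "(?B n)\<^sup>2 + c\<^sup>2 * (x (Suc n))\<^sup>2 \<le> (?B (Suc n))\<^sup>2"
      using N_c_square_lower[OF c, of "Suc n" "?B n" "\<bar>x (Suc n)\<bar>"] by simp
    ultimately show ?thesis using up by linarith
  qed
  have mono: "(?B m)\<^sup>2 - (?A m)\<^sup>2 \<le> (?B n)\<^sup>2 - (?A n)\<^sup>2" if "m \<le> n" for n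
    using that
  proof (induction n rule: dec_induct)
    case (step k)
    then show ?case using step_le[of k] by linarith
  qed simp
  have "?A m \<le> ?B m" using shrink by (intro M_norm_mono c) auto
  then have "0 < ?B m" using m0 incA[of m] by linarith
  then have "?A m < ?B m" using shrink shrink' by (intro M_norm_strict_contraction c) auto
  then have "(?A m)\<^sup>2 < (?B m)\<^sup>2" using M_norm_nonneg[OF c] by (intro power_strict_mono) auto
  moreover have "(?B m)\<^sup>2 - (?A m)\<^sup>2 \<le> b\<^sup>2 - a\<^sup>2"
    by (rule tendsto_lowerbound[OF tendsto_diff[OF tendsto_power[OF b] tendsto_power[OF a]]])
      (auto simp: eventually_sequentially intro!: exI[of _ m] mono)
  ultimately have "a\<^sup>2 < b\<^sup>2" by linarith
  then show ?thesis using \<open>0 < b\<close> by (intro power_less_imp_less_base[of a 2 b]) auto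
qed

section \<open>Coordinates on the completion\<close>

text \<open>A norm-one extension from \<open>c00\<close> is chosen; by density it is the only bounded linear one.\<close>

definition coordinate :: "((nat \<Rightarrow> real) \<Rightarrow> 'a::real_normed_vector) \<Rightarrow> nat \<Rightarrow> 'a \<Rightarrow> real" where
  "coordinate \<iota> j = (SOME L. bounded_linear L \<and> (\<forall>x\<in>c00. L (\<iota> x) = x j) \<and> (\<forall>u. \<bar>L u\<bar> \<le> norm u))"

locale X_c =
  fixes c :: real and \<iota> :: "(nat \<Rightarrow> real) \<Rightarrow> 'a::banach"
  assumes c: "0 < c" "c < 1" and completion: "completion_A (N_c c) \<iota>"
begin

abbreviation M where "M \<equiv> M_norm (N_c c)"
abbreviation e where "e \<equiv> canonical_basis \<iota>"

lemma iota_add: "x \<in> c00 \<Longrightarrow> y \<in> c00 \<Longrightarrow> \<iota> (\<lambda>j. x j + y j) = \<iota> x + \<iota> y"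
  and iota_scale: "x \<in> c00 \<Longrightarrow> \<iota> (\<lambda>j. a * x j) = a *\<^sub>R \<iota> x"
  and iota_dense: "closure (\<iota> ` c00) = UNIV"
  using completion unfolding completion_A_def by blast+

lemma norm_iota:
  assumes "\<And>j. n < j \<Longrightarrow> x j = 0"
  shows "norm (\<iota> x) = M n x"
proof -
  have "x \<in> c00" by (rule c00I) (rule assms)
  then have "norm (\<iota> x) = c00_norm (N_c c) x"
    using completion unfolding completion_A_def by blast
  then show ?thesis using c00_norm_eq_M_norm[OF c assms] by simp
qed

lemma abs_coordinate_le_norm_iota:
  assumes "x \<in> c00"
  shows "\<bar>x j\<bar> \<le> norm (\<iota> x)"
proof -
  obtain n where n: "\<And>i. n < i \<Longrightarrow> x i = 0" using c00_bounded_support[OF assms] by blast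
  then have "norm (\<iota> x) = M (max j n) x" by (intro norm_iota) auto
  then show ?thesis using abs_coordinate_le_M_norm[OF c, of j "max j n" x] by simp
qed

lemma
  shows bounded_linear_coordinate: "bounded_linear (coordinate \<iota> j)"
    and coordinate_iota: "x \<in> c00 \<Longrightarrow> coordinate \<iota> j (\<iota> x) = x j"
    and abs_coordinate_le: "\<bar>coordinate \<iota> j u\<bar> \<le> norm u"
proof -
  obtain L :: "'a \<Rightarrow> real" where "bounded_linear L" "\<And>x. x \<in> c00 \<Longrightarrow> L (\<iota> x) = x j"
    "\<And>u. norm (L u) \<le> norm u"
    by (rule bounded_linear_extension[of \<iota> "\<lambda>x. x j", OF iota_add iota_scale iota_dense])
      (use abs_coordinate_le_norm_iota in simp_all)
  then have "\<exists>L. bounded_linear L \<and> (\<forall>x\<in>c00. L (\<iota> x) = x j) \<and> (\<forall>u. \<bar>L u\<bar> \<le> norm u)"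
    by auto
  from someI_ex[OF this, folded coordinate_def]
  show "bounded_linear (coordinate \<iota> j)" "x \<in> c00 \<Longrightarrow> coordinate \<iota> j (\<iota> x) = x j"
    "\<bar>coordinate \<iota> j u\<bar> \<le> norm u" by auto
qed

lemma iota_multiply_unit: "\<iota> (\<lambda>j. w j * (if j = n then 1 else 0)) = w n *\<^sub>R e n"
proof -
  have "(\<lambda>j. w j * (if j = n then 1 else 0)) = (\<lambda>j. w n * (if j = n then 1 else 0))" by auto
  then show ?thesis using iota_scale[OF unit_c00] by (simp only: canonical_basis_def)
qed

lemma iota_truncation: "\<iota> (\<lambda>j. if j \<le> n then a j else 0) = (\<Sum>j\<le>n. a j *\<^sub>R e j)"
proof (induction n)
  case 0
  have "\<iota> (\<lambda>j. a 0 * (if j = 0 then 1 else 0)) = a 0 *\<^sub>R e 0"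
    unfolding canonical_basis_def by (intro iota_scale unit_c00)
  moreover have "(\<lambda>j. a 0 * (if j = 0 then 1 else 0)) = (\<lambda>j. if j \<le> 0 then a j else 0)" by auto
  ultimately show ?case by simp
next
  case (Suc n)
  let ?x = "\<lambda>j. if j \<le> n then a j else 0" and ?d = "\<lambda>j. if j = Suc n then 1 else 0"
  have x: "?x \<in> c00" by (rule c00I[of n]) simp
  note d = unit_c00[of "Suc n"]
  have "(\<lambda>j. if j \<le> Suc n then a j else 0) = (\<lambda>j. ?x j + a (Suc n) * ?d j)" by (auto simp: le_Suc_eq)
  then have "\<iota> (\<lambda>j. if j \<le> Suc n then a j else 0) = \<iota> ?x + a (Suc n) *\<^sub>R \<iota> ?d"
    using iota_add[OF x c00_mult[OF d]] iota_scale[OF d] by simp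
  then show ?case using Suc by (simp add: canonical_basis_def)
qed

lemma iota_eq_sum:
  assumes "x \<in> c00"
  obtains n where "\<iota> x = (\<Sum>j\<le>n. x j *\<^sub>R e j)"
proof -
  obtain n where n: "\<And>i. n < i \<Longrightarrow> x i = 0" using c00_bounded_support[OF assms] by blast
  then have "x = (\<lambda>j. if j \<le> n then x j else 0)" by (auto simp: not_le)
  then show thesis using that iota_truncation[of n x] by simp
qed

definition P :: "nat \<Rightarrow> 'a \<Rightarrow> 'a" where
  "P n u = (\<Sum>j\<le>n. coordinate \<iota> j u *\<^sub>R e j)"

lemma bounded_linear_P: "bounded_linear (P n)"
  unfolding P_def
  by (intro bounded_linear_sum bounded_linear_compose[OF bounded_linear_scaleR_left]
      bounded_linear_coordinate)

lemma norm_P: "norm (P n u) = M n (\<lambda>j. coordinate \<iota> j u)"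
proof -
  have "norm (P n u) = M n (\<lambda>j. if j \<le> n then coordinate \<iota> j u else 0)"
    unfolding P_def iota_truncation[symmetric] by (rule norm_iota) simp
  also have "\<dots> = M n (\<lambda>j. coordinate \<iota> j u)" by (rule M_norm_cong) simp
  finally show ?thesis .
qed

lemma P_iota:
  assumes "x \<in> c00"
  shows "\<forall>\<^sub>F n in sequentially. P n (\<iota> x) = \<iota> x"
proof -
  obtain m where m: "\<And>i. m < i \<Longrightarrow> x i = 0" using c00_bounded_support[OF assms] by blast
  have "P n (\<iota> x) = \<iota> x" if "m \<le> n" for n
  proof -
    have "x = (\<lambda>j. if j \<le> n then x j else 0)" using m that by (auto simp: not_le)
    then show ?thesis using iota_truncation[of n x] coordinate_iota[OF assms] by (simp add: P_def)
  qed
  then show ?thesis by (auto simp: eventually_sequentially)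
qed

text \<open>On \<open>\<iota> ` c00\<close> the norms of the partial sums increase to a value attained at a finite stage.\<close>

lemma norm_P_le: "norm (P n u) \<le> norm u"
proof -
  have dense: "norm (P n (\<iota> x)) - norm (\<iota> x) \<le> 0" if x: "x \<in> c00" for x
  proof -
    obtain m where m: "n \<le> m" "P m (\<iota> x) = \<iota> x"
      using eventually_happens[OF eventually_conj[OF P_iota[OF x] eventually_ge_at_top[of n]]] by auto
    show ?thesis
      using incseqD[OF incseq_M_norm[OF c] m(1), of "\<lambda>j. coordinate \<iota> j (\<iota> x)"] m(2)
      by (metis norm_P diff_le_0_iff_le)
  qed
  have "norm (P n u) - norm u \<le> 0"
    by (rule continuous_le_on_closure[where S = "\<iota> ` c00" and f = "\<lambda>u. norm (P n u) - norm u"])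
      (auto simp: iota_dense intro!: dense[simplified] continuous_on_diff continuous_on_norm
        linear_continuous_on[OF bounded_linear_P] continuous_on_id)
  then show ?thesis by simp
qed

lemma approximation_iota:
  assumes "0 < r"
  obtains x where "x \<in> c00" "norm (u - \<iota> x) < r"
proof -
  have "u \<in> closure (\<iota> ` c00)" by (simp add: iota_dense)
  then show thesis
    using that assms unfolding closure_approachable by (auto simp: dist_norm norm_minus_commute)
qed

lemma P_tendsto: "(\<lambda>n. P n u) \<longlonglongrightarrow> u"
proof (rule tendstoI)
  fix r :: real assume "0 < r"
  then obtain x where x: "x \<in> c00" "norm (u - \<iota> x) < r / 2" using approximation_iota[of "r / 2"] by auto
  from P_iota[OF x(1)] show "\<forall>\<^sub>F n in sequentially. dist (P n u) u < r"
  proof eventually_elim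
    case (elim n)
    have "P n u - u = P n (u - \<iota> x) - (u - \<iota> x)"
      using elim linear_diff[OF bounded_linear.linear[OF bounded_linear_P]] by simp
    then have "norm (P n u - u) \<le> norm (P n (u - \<iota> x)) + norm (u - \<iota> x)"
      by (metis norm_triangle_ineq4)
    then show ?case using norm_P_le[of n "u - \<iota> x"] x(2) by (simp add: dist_norm)
  qed
qed

lemma M_coordinates_tendsto: "(\<lambda>n. M n (\<lambda>j. coordinate \<iota> j u)) \<longlonglongrightarrow> norm u"
  using tendsto_norm[OF P_tendsto] by (simp add: norm_P)

text \<open>The coordinates of \<open>u\<close> differ by at most \<open>norm (u - \<iota> x)\<close> from those of a finitely supported
  \<open>x\<close>, which vanish eventually.\<close>

lemma coordinates_tendsto_0: "(\<lambda>j. coordinate \<iota> j u) \<longlonglongrightarrow> 0"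
proof (rule tendstoI)
  fix r :: real assume "0 < r"
  then obtain x where x: "x \<in> c00" "norm (u - \<iota> x) < r" using approximation_iota by blast
  obtain m where m: "\<And>i. m < i \<Longrightarrow> x i = 0" using c00_bounded_support[OF x(1)] by blast
  have "dist (coordinate \<iota> j u) 0 < r" if "m < j" for j
  proof -
    have "coordinate \<iota> j (u - \<iota> x) = coordinate \<iota> j u"
      using linear_diff[OF bounded_linear.linear[OF bounded_linear_coordinate]]
        coordinate_iota[OF x(1)] m[OF that] by simp
    then show ?thesis using abs_coordinate_le[of j "u - \<iota> x"] x(2) by simp
  qed
  then show "\<forall>\<^sub>F j in sequentially. dist (coordinate \<iota> j u) 0 < r"
    by (auto simp: eventually_sequentially intro!: exI[of _ "Suc m"])
qed

section \<open>The operator\<close>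

text \<open>Coordinatewise multiplication by \<open>j/(j+1)\<close> is a contraction on \<open>c00\<close> because the norm is
  monotone in the moduli of the coordinates. Its extension satisfies the description that defines
  \<open>D_op\<close>; any other operator doing so agrees with it on the basis, hence on the dense span.\<close>

lemma
  shows bounded_linear_D: "bounded_linear (D_op \<iota>)"
    and D_iota: "x \<in> c00 \<Longrightarrow> D_op \<iota> (\<iota> x) = \<iota> (\<lambda>j. real j / real (j + 1) * x j)"
proof -
  let ?w = "\<lambda>j. real j / real (j + 1)"
  let ?T = "\<lambda>x. \<iota> (\<lambda>j. ?w j * x j)"
  have T_bound: "norm (?T x) \<le> norm (\<iota> x)" if x: "x \<in> c00" for x
  proof -
    obtain n where n: "\<And>i. n < i \<Longrightarrow> x i = 0" using c00_bounded_support[OF x] by blast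
    then have "norm (?T x) = M n (\<lambda>j. ?w j * x j)" "norm (\<iota> x) = M n x"
      by (intro norm_iota; simp)+
    moreover have "M n (\<lambda>j. ?w j * x j) \<le> M n x"
      by (intro M_norm_mono c abs_weight_mult_le)
    ultimately show ?thesis by (simp only:)
  qed
  have T_add: "?T (\<lambda>j. x j + y j) = ?T x + ?T y" if "x \<in> c00" "y \<in> c00" for x y
    using iota_add[OF c00_mult[OF that(1), of ?w] c00_mult[OF that(2), of ?w]]
    by (simp only: distrib_left)
  have T_scale: "?T (\<lambda>j. a * x j) = a *\<^sub>R ?T x" if "x \<in> c00" for a x
    using iota_scale[OF c00_mult[OF that], of a ?w] by (simp add: mult.left_commute)
  obtain D where D: "bounded_linear D" "\<And>x. x \<in> c00 \<Longrightarrow> D (\<iota> x) = ?T x"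
    by (rule bounded_linear_extension[of \<iota> ?T, OF iota_add iota_scale iota_dense T_add T_scale T_bound])
      (assumption | rule that)+
  have basis: "D (e n) = ?w n *\<^sub>R e n" for n
    using D(2)[OF unit_c00[of n]] iota_multiply_unit[of ?w n]
    unfolding canonical_basis_def by (simp only:)
  have "D_op \<iota> = D"
    unfolding D_op_def
  proof (rule the_equality)
    show "bounded_linear D \<and> D (e 0) = 0 \<and> (\<forall>n\<ge>1. D (e n) = ?w n *\<^sub>R e n)"
      using D(1) basis by simp
  next
    fix D' assume D': "bounded_linear D' \<and> D' (e 0) = 0 \<and> (\<forall>n\<ge>1. D' (e n) = ?w n *\<^sub>R e n)"
    have basis': "D' (e n) = D (e n)" for n
      using D' basis[of n] by (cases "n = 0") auto
    show "D' = D"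
    proof (rule bounded_linear_eq_on_dense[OF _ D(1) iota_dense])
      show "bounded_linear D'" using D' by simp
      fix u assume "u \<in> \<iota> ` c00"
      then obtain x n where "u = (\<Sum>j\<le>n. x j *\<^sub>R e j)" by (metis iota_eq_sum imageE)
      moreover have "linear D'" "linear D" using D' D(1) by (auto simp: bounded_linear.linear)
      ultimately show "D' u = D u" by (simp add: linear_sum linear_scale basis')
    qed
  qed
  then show "bounded_linear (D_op \<iota>)" "x \<in> c00 \<Longrightarrow> D_op \<iota> (\<iota> x) = ?T x"
    using D by auto
qed

lemma coordinate_D: "coordinate \<iota> j (D_op \<iota> u) = real j / real (j + 1) * coordinate \<iota> j u"
proof -
  have "(\<lambda>u. coordinate \<iota> j (D_op \<iota> u)) = (\<lambda>u. real j / real (j + 1) * coordinate \<iota> j u)"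
  proof (rule bounded_linear_eq_on_dense[OF _ _ iota_dense])
    show "bounded_linear (\<lambda>u. coordinate \<iota> j (D_op \<iota> u))"
      by (rule bounded_linear_compose[OF bounded_linear_coordinate bounded_linear_D])
    show "bounded_linear (\<lambda>u. real j / real (j + 1) * coordinate \<iota> j u)"
      by (rule bounded_linear_const_mult[OF bounded_linear_coordinate])
    fix u assume "u \<in> \<iota> ` c00"
    then obtain x where "x \<in> c00" "u = \<iota> x" by blast
    then show "coordinate \<iota> j (D_op \<iota> u) = real j / real (j + 1) * coordinate \<iota> j u"
      by (simp only: D_iota coordinate_iota c00_mult)
  qed
  then show ?thesis by meson
qed

lemma norm_D_less: "u \<noteq> 0 \<Longrightarrow> norm (D_op \<iota> u) < norm u"
  by (rule weighted_limit_strict[OF c coordinate_D coordinates_tendsto_0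
        M_coordinates_tendsto M_coordinates_tendsto]) simp

lemma norm_basis: "norm (e n) = 1"
  and D_basis: "D_op \<iota> (e n) = (real n / real (n + 1)) *\<^sub>R e n"
proof -
  let ?d = "\<lambda>j. if j = n then 1 else (0::real)"
  have "M n ?d = 1"
  proof (cases n)
    case (Suc k)
    have "M k ?d = M k (\<lambda>j. 0 * ?d j)" by (rule M_norm_cong) (simp add: Suc)
    also have "\<dots> = norm (\<iota> (\<lambda>j. 0 * ?d j))" by (rule norm_iota[symmetric]) simp
    also have "\<dots> = 0" using iota_scale[OF unit_c00, of 0] by simp
    finally show ?thesis using Suc by (simp add: N_c_zero_left)
  qed simp
  then show "norm (e n) = 1" unfolding canonical_basis_def by (subst norm_iota[of n]) auto
  show "D_op \<iota> (e n) = (real n / real (n + 1)) *\<^sub>R e n"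
    using D_iota[OF unit_c00[of n]] iota_multiply_unit[of "\<lambda>j. real j / real (j + 1)" n]
    unfolding canonical_basis_def by (simp only:)
qed

lemma onorm_D_ge_1: "1 \<le> onorm (D_op \<iota>)"
proof (rule LIMSEQ_le_const2)
  show "(\<lambda>n. real n / real (n + 1)) \<longlonglongrightarrow> 1" by real_asymp
  have "real n / real (n + 1) \<le> onorm (D_op \<iota>)" for n
    using onorm[OF bounded_linear_D, of "e n"] by (simp add: norm_basis D_basis)
  then show "\<exists>N. \<forall>n\<ge>N. real n / real (n + 1) \<le> onorm (D_op \<iota>)" by blast
qed

end

theorem proposition4p1:
  fixes c :: real and \<iota> :: "(nat \<Rightarrow> real) \<Rightarrow> 'a::banach"
  assumes "0 < c" and "c < 1"
    and "completion_A (N_c c) \<iota>"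
  shows "(\<forall>x::'a. x \<noteq> 0 \<longrightarrow> norm (D_op \<iota> x) < norm x) \<and> \<not> attains_norm (D_op \<iota>)"
proof -
  interpret X_c c \<iota> using assms by unfold_locales
  have "norm (D_op \<iota> x) \<noteq> onorm (D_op \<iota>)" if "norm x = 1" for x
    using norm_D_less[of x] onorm_D_ge_1 that by force
  then show ?thesis using norm_D_less by (auto simp: attains_norm_def)
qed

end
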